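(* Let $\Bbbk$ be a subfield of $\mathbb{C}$ and $A$ a positively based $\Bbbk$-algebra of finite dimension $n$. Let $\mathcal{L}$ be a left cell and let $\mathcal{J}=\mathcal{J}(\mathcal{L})$ be the apex of $C_{\mathcal{L}}$. Then the two-sided cell $\mathcal{J}$ is good.
   Context: Positively based algebra: $A$ is a unital associative $\Bbbk$-algebra with a fixed basis $\mathbf{B}=\{a_1,\dots,a_n\}$ such that $a_ia_j=\sum_{k}\gamma_{i,j}^{(k)}a_k$ with all $\gamma_{i,j}^{(k)}\in\mathbb{R}_{\ge 0}$; it is assumed that $a_1$ is the unit of $A$. Modules are left modules. Cells: put $\mathbf{n}=\{1,\dots,n\}$ and $i\star j=\{k:\gamma_{i,j}^{(k)}>0\}$, extended to subsets by taking unions. Write $i\le_L j$ if $j\in s\star i$ for some $s\in\mathbf{n}$, and $i\le_J j$ if $j\in s_1\star i\star s_2$ for some $s_1,s_2\in\mathbf{n}$; these are preorders. The equivalence classes of the associated equivalence relations are the left cells, respectively two-sided cells, and the preorders induce partial orders on them. Cell module: for a left cell $\mathcal{L}$, let $\overline{\mathcal{L}}$ be the union of all left cells $\mathcal{L}'\ge_L\mathcal{L}$; the spans of $\{a_j:j\in\overline{\mathcal{L}}\}$ and of $\{a_j:j\in\overline{\mathcal{L}}\setminus\mathcal{L}\}$ are submodules of ${}_AA$, and $C_{\mathcal{L}}$ is the quotient of the first by the second. Apex: $\mathcal{J}(\mathcal{L})$ is the maximum element, with respect to $\le_J$ (it exists), of the set of two-sided cells containing some $i$ with $a_i\cdot C_{\mathcal{L}}\ne0$.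 For a two-sided cell $\mathcal{J}$, let $I_{\mathcal{J}}$ be the two-sided ideal of $A$ spanned by all $a_i$ with $i\not\le_J\mathcal{J}$, let $A_{\mathcal{J}}=A/I_{\mathcal{J}}$, and let $\overline{a}_j$ denote the image of $a_j$ in $A_{\mathcal{J}}$; the $\overline{a}_j$ with $j\le_J\mathcal{J}$ form a basis of $A_{\mathcal{J}}$ with non-negative real structure constants. The two-sided cell $\mathcal{J}$ is called good if there is a linear combination $a$ of all $\overline{a}_j$, $j\in\mathcal{J}$, with positive real coefficients, such that $$a^m+v_{m-1}a^{m-1}+\dots+v_{k+1}a^{k+1}=v_ka^k+v_{k-1}a^{k-1}+\dots+v_la^l$$ for some integers $m>k\ge l\ge1$ and some non-negative real numbers $v_{m-1},v_{m-2},\dots,v_l$ with $v_l\ne0$. Here real linear combinations and the displayed equality are understood in the real algebra with basis $\{\overline{a}_j:j\le_J\mathcal{J}\}$ and the same structure constants. *)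

theory Defs
  imports Complex_Main "HOL-Library.Nonpos_Ints"
begin

text \<open>
  A subfield of the complex numbers is given as a field \<open>'k\<close> together with a field embedding
  \<open>\<iota>\<close> into the complex numbers; embeddings of fields are automatically injective. Positivity of
  elements of \<open>'k\<close> is always read off their images under \<open>\<iota>\<close>. The values of \<open>\<gamma>\<close> and \<open>a\<close> outside
  the index range \<open>{1..n}\<close> are irrelevant.
\<close>

locale positively_based_algebra = vector_space scale
  for scale :: "'k::field \<Rightarrow> 'a::ring_1 \<Rightarrow> 'a" (infixr \<open>*s\<close> 75)
  and \<iota> :: "'k \<Rightarrow> complex"
  and n :: nat
  and a :: "nat \<Rightarrow> 'a"
  and \<gamma> :: "nat \<Rightarrow> nat \<Rightarrow> nat \<Rightarrow> 'k" +
  assumes \<iota>_one: "\<iota> 1 = 1"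
    and \<iota>_add: "\<iota> (x + y) = \<iota> x + \<iota> y"
    and \<iota>_mult: "\<iota> (x * y) = \<iota> x * \<iota> y"
    and scale_mult_left: "(x *s u) * v = x *s (u * v)"
    and scale_mult_right: "u * (x *s v) = x *s (u * v)"
    and n_pos: "n \<ge> 1"
    and basis_inj: "inj_on a {1..n}"
    and basis_independent: "independent (a ` {1..n})"
    and basis_span: "span (a ` {1..n}) = UNIV"
    and basis_unit: "a 1 = 1"
    and basis_mult: "\<lbrakk>i \<in> {1..n}; j \<in> {1..n}\<rbrakk> \<Longrightarrow> a i * a j = (\<Sum>k\<in>{1..n}. \<gamma> i j k *s a k)"
    and \<gamma>_nonneg: "\<lbrakk>i \<in> {1..n}; j \<in> {1..n}; k \<in> {1..n}\<rbrakk> \<Longrightarrow> \<iota> (\<gamma> i j k) \<in> \<real>\<^sub>\<ge>\<^sub>0"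
begin

definition real_const :: "nat \<Rightarrow> nat \<Rightarrow> nat \<Rightarrow> real" where
  "real_const i j k = Re (\<iota> (\<gamma> i j k))"

definition star :: "nat \<Rightarrow> nat \<Rightarrow> nat set" where
  "star i j = {k \<in> {1..n}. real_const i j k > 0}"

definition star_set :: "nat set \<Rightarrow> nat set \<Rightarrow> nat set" where
  "star_set X Y = (\<Union>i\<in>X. \<Union>j\<in>Y. star i j)"

definition le_L :: "nat \<Rightarrow> nat \<Rightarrow> bool" where
  "le_L i j \<longleftrightarrow> i \<in> {1..n} \<and> (\<exists>s\<in>{1..n}. j \<in> star s i)"

definition le_J :: "nat \<Rightarrow> nat \<Rightarrow> bool" where
  "le_J i j \<longleftrightarrow> i \<in> {1..n} \<and> (\<exists>s\<in>{1..n}. \<exists>t\<in>{1..n}. j \<in> star_set (star s i) {t})"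

definition left_cells :: "nat set set" where
  "left_cells = {1..n} // {(i, j). le_L i j \<and> le_L j i}"

definition two_sided_cells :: "nat set set" where
  "two_sided_cells = {1..n} // {(i, j). le_J i j \<and> le_J j i}"

definition left_cell_le :: "nat set \<Rightarrow> nat set \<Rightarrow> bool" where
  "left_cell_le L L' \<longleftrightarrow> (\<exists>i\<in>L. \<exists>j\<in>L'. le_L i j)"

definition two_sided_cell_le :: "nat set \<Rightarrow> nat set \<Rightarrow> bool" where
  "two_sided_cell_le J J' \<longleftrightarrow> (\<exists>i\<in>J. \<exists>j\<in>J'. le_J i j)"

definition up_closure :: "nat set \<Rightarrow> nat set" where
  "up_closure L = \<Union>{L' \<in> left_cells. left_cell_le L L'}"

definition upper_submodule :: "nat set \<Rightarrow> 'a set" where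
  "upper_submodule L = span (a ` up_closure L)"

definition lower_submodule :: "nat set \<Rightarrow> 'a set" where
  "lower_submodule L = span (a ` (up_closure L - L))"

text \<open>
  Elements of the cell module are cosets of \<open>lower_submodule L\<close>, which is therefore its zero.
\<close>

definition cell_module :: "nat set \<Rightarrow> 'a set set" where
  "cell_module L = (\<lambda>x. (\<lambda>y. x + y) ` lower_submodule L) ` upper_submodule L"

definition cell_module_act :: "nat set \<Rightarrow> 'a \<Rightarrow> 'a set \<Rightarrow> 'a set" where
  "cell_module_act L b X = {b * x + y |x y. x \<in> X \<and> y \<in> lower_submodule L}"

definition annihilates_cell_module :: "'a \<Rightarrow> nat set \<Rightarrow> bool" where
  "annihilates_cell_module b L \<longleftrightarrow> (\<forall>X\<in>cell_module L. cell_module_act L b X = lower_submodule L)"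

definition nonannihilating_cells :: "nat set \<Rightarrow> nat set set" where
  "nonannihilating_cells L =
     {J \<in> two_sided_cells. \<exists>i\<in>J. \<not> annihilates_cell_module (a i) L}"

definition apex :: "nat set \<Rightarrow> nat set" where
  "apex L = (THE J. J \<in> nonannihilating_cells L \<and>
                    (\<forall>J'\<in>nonannihilating_cells L. two_sided_cell_le J' J))"

definition below :: "nat set \<Rightarrow> nat set" where
  "below J = {i \<in> {1..n}. \<exists>j\<in>J. le_J i j}"

definition cell_ideal :: "nat set \<Rightarrow> 'a set" where
  "cell_ideal J = span (a ` ({1..n} - below J))"

text \<open>
  The algebra \<open>A / cell_ideal J\<close> has as basis the images of the \<open>a j\<close> with \<open>j \<in> below J\<close>, and by
  the following lemma its structure constants in this basis are the restrictions of \<open>\<gamma>\<close>.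
\<close>

lemma structure_constants_mod_cell_ideal:
  assumes "i \<in> below J" "j \<in> below J"
  shows "a i * a j - (\<Sum>k\<in>below J. \<gamma> i j k *s a k) \<in> cell_ideal J"
proof -
  have sub: "below J \<subseteq> {1..n}" by (auto simp: below_def)
  have "a i * a j = (\<Sum>k\<in>{1..n} - below J. \<gamma> i j k *s a k) + (\<Sum>k\<in>below J. \<gamma> i j k *s a k)"
    using assms sub basis_mult[of i j]
    by (simp only: sum.subset_diff[OF sub finite_atLeastAtMost, symmetric] subset_iff)
  moreover have "(\<Sum>k\<in>{1..n} - below J. \<gamma> i j k *s a k) \<in> cell_ideal J"
    unfolding cell_ideal_def by (intro span_sum span_scale span_base imageI)
  ultimately show ?thesis by simp
qed

text \<open>
  The real algebra with basis indexed by \<open>below J\<close> and the same structure constants: its elements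
  are the coefficient functions \<open>nat \<Rightarrow> real\<close> vanishing outside \<open>below J\<close>.
\<close>

definition real_mult :: "nat set \<Rightarrow> (nat \<Rightarrow> real) \<Rightarrow> (nat \<Rightarrow> real) \<Rightarrow> nat \<Rightarrow> real" where
  "real_mult J x y = (\<lambda>k. if k \<in> below J
     then \<Sum>i\<in>below J. \<Sum>j\<in>below J. x i * y j * real_const i j k else 0)"

primrec real_power :: "nat set \<Rightarrow> (nat \<Rightarrow> real) \<Rightarrow> nat \<Rightarrow> nat \<Rightarrow> real" where
  "real_power J x 0 = (\<lambda>k. if k = 1 then 1 else 0)"
| "real_power J x (Suc m) = real_mult J x (real_power J x m)"

definition good :: "nat set \<Rightarrow> bool" where
  "good J \<longleftrightarrow> J \<in> two_sided_cells \<and>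
     (\<exists>w :: nat \<Rightarrow> real. (\<forall>j\<in>J. w j > 0) \<and> (\<forall>j. j \<notin> J \<longrightarrow> w j = 0) \<and>
       (\<exists>(m::nat) (k::nat) (l::nat) (v :: nat \<Rightarrow> real).
          m > k \<and> k \<ge> l \<and> l \<ge> 1 \<and> (\<forall>i\<in>{l..<m}. v i \<ge> 0) \<and> v l \<noteq> 0 \<and>
          (\<forall>t. real_power J w m t + (\<Sum>i\<in>{k<..<m}. v i * real_power J w i t)
                = (\<Sum>i\<in>{l..k}. v i * real_power J w i t))))"

end

end

theory Submission
  imports Defs "HOL-Analysis.Function_Metric"
begin

text \<open>
  Goodness of a two-sided cell \<open>J\<close> holds in a strong form: the apex carries an
  element \<open>w\<close> with strictly positive coefficients on \<open>J\<close> and \<open>w\<^sup>2 = \<mu> w\<close> for some \<open>\<mu> > 0\<close>, so the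
  required relation is the one with \<open>m = 2\<close> and \<open>k = l = 1\<close>.

  The apex is idempotent. Write \<open>N\<close> for the set of indices that do not annihilate the cell module.
  Any two elements of a left cell are related by \<open>\<le>\<^sub>L\<close> both ways. Hence, if \<open>i\<close> and \<open>i'\<close> are in \<open>N\<close>,
  then something in \<open>i' \<star> s \<star> i\<close> is in \<open>N\<close> for a suitable \<open>s\<close>. So \<open>N\<close> is directed for \<open>\<le>\<^sub>J\<close>, which
  gives the existence of the apex \<open>J\<close>. For \<open>i = i'\<close> greatest in \<open>N\<close>, the product found lies in \<open>J\<close> by
  maximality, and with it the factor in \<open>i' \<star> s\<close>; thus \<open>J \<star> J\<close> meets \<open>J\<close> (\<open>apex_properties\<close>).

  An idempotent cell is simple. Since \<open>J \<star> J\<close> meets \<open>J\<close>, every element of \<open>J\<close> is in \<open>J \<star> J\<close>, and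
  therefore also in \<open>J \<star> j \<star> J\<close> for each \<open>j\<close> in \<open>J\<close> (\<open>idempotent_cell_simple\<close>).

  A simple algebra with non-negative structure constants has a positive quasi-idempotent. Let \<open>u\<close>
  be the sum of the basis. By simplicity \<open>u y u\<close> has only positive coefficients for each nonzero
  \<open>y \<ge> 0\<close>. Rescaled to total coefficient \<open>1\<close>, the elements \<open>u y u\<close> form a compact set, which is a
  semigroup under the rescaled product because \<open>(u y u)(u z u) = u (y u u z) u\<close>. A compact Hausdorff
  semigroup contains an idempotent (\<open>compact_semigroup_has_idempotent\<close>), and an idempotent for the
  rescaled product is an element \<open>w\<close> as wanted (\<open>positive_quasi_idempotent\<close>).
\<close>

section \<open>Idempotents in compact semigroups\<close>

text \<open>
  The Ellis--Numakura lemma. By compactness and Zorn's lemma there is a minimal nonempty compact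
  subsemigroup \<open>P\<close>. For \<open>e\<close> in \<open>P\<close> both \<open>P e\<close> and the set of \<open>x\<close> in \<open>P\<close> with \<open>x e = e\<close> are compact
  subsemigroups of \<open>P\<close>, the second one being nonempty because the first is all of \<open>P\<close>. So the
  second is all of \<open>P\<close> too and contains \<open>e\<close>.
\<close>

lemma compact_semigroup_has_idempotent:
  fixes S :: "'s::t2_space set" and f :: "'s \<Rightarrow> 's \<Rightarrow> 's"
  assumes S: "compact S" "S \<noteq> {}"
    and closed: "\<And>x y. x \<in> S \<Longrightarrow> y \<in> S \<Longrightarrow> f x y \<in> S"
    and assoc: "\<And>x y z. x \<in> S \<Longrightarrow> y \<in> S \<Longrightarrow> z \<in> S \<Longrightarrow> f (f x y) z = f x (f y z)"
    and cont: "\<And>y. y \<in> S \<Longrightarrow> continuous_on S (\<lambda>x. f x y)"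
  shows "\<exists>e\<in>S. f e e = e"
proof -
  define sub where "sub P \<longleftrightarrow> P \<subseteq> S \<and> P \<noteq> {} \<and> compact P \<and> (\<forall>x\<in>P. \<forall>y\<in>P. f x y \<in> P)" for P
  \<comment> \<open>Zorn's lemma yields maximal sets, hence the passage to complements.\<close>
  define \<A> where "\<A> = {S - P |P. sub P}"
  have "sub S" using S closed by (auto simp: sub_def)
  then have ne: "\<A> \<noteq> {}" by (auto simp: \<A>_def)
  have chain: "\<Union>\<C> \<in> \<A>" if C: "\<C> \<noteq> {}" "subset.chain \<A> \<C>" for \<C>
  proof -
    define \<D> where "\<D> = (\<lambda>U. S - U) ` \<C>"
    have sub_compl: "sub (S - U) \<and> U \<subseteq> S" if "U \<in> \<C>" for U
    proof -
      from that C(2) obtain P where "U = S - P" "sub P"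
        by (auto simp: subset.chain_def \<A>_def)
      moreover from this have "S - U = P" by (auto simp: sub_def)
      ultimately show ?thesis by auto
    qed
    have D: "sub P" if "P \<in> \<D>" for P
      using that sub_compl by (auto simp: \<D>_def)
    have linear: "P \<subseteq> Q \<or> Q \<subseteq> P" if "P \<in> \<D>" "Q \<in> \<D>" for P Q
      using that C(2) unfolding \<D>_def subset.chain_def by blast
    have Dne: "\<D> \<noteq> {}" using C(1) by (simp add: \<D>_def)
    have fin: "\<exists>P\<in>\<D>. P \<subseteq> \<Inter>F" if "finite F" "F \<noteq> {}" "F \<subseteq> \<D>" for F
      using that
    proof (induction F rule: finite_ne_induct)
      case (singleton P) then show ?case by auto
    next
      case (insert P F)
      then obtain Q where Q: "Q \<in> \<D>" "Q \<subseteq> \<Inter>F" "P \<in> \<D>" by auto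
      with linear[of P Q] show ?case by auto
    qed
    have "S \<inter> \<Inter>\<D> \<noteq> {}"
    proof (rule compact_imp_fip[OF S(1)])
      show "closed T" if "T \<in> \<D>" for T
        using D[OF that] by (auto simp: sub_def compact_imp_closed)
      show "S \<inter> \<Inter>F' \<noteq> {}" if F: "finite F'" "F' \<subseteq> \<D>" for F'
      proof (cases "F' = {}")
        case True then show ?thesis using S by simp
      next
        case False
        then obtain P where "P \<in> \<D>" "P \<subseteq> \<Inter>F'" using fin F by blast
        with D[of P] show ?thesis unfolding sub_def by blast
      qed
    qed
    moreover have "\<Inter>\<D> \<subseteq> S" using D Dne unfolding sub_def by blast
    moreover have "compact (\<Inter>\<D>)"
    proof -
      obtain P where "P \<in> \<D>" using Dne by auto
      then have "compact P" "\<Inter>\<D> \<subseteq> P" using D by (auto simp: sub_def)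
      moreover have "closed (\<Inter>\<D>)"
        using D by (intro closed_Inter) (auto simp: sub_def compact_imp_closed)
      ultimately show ?thesis
        by (metis compact_Int_closed inf.absorb_iff2)
    qed
    moreover have "\<forall>x\<in>\<Inter>\<D>. \<forall>y\<in>\<Inter>\<D>. f x y \<in> \<Inter>\<D>"
      using D unfolding sub_def by blast
    ultimately have "sub (\<Inter>\<D>)" unfolding sub_def by blast
    moreover have "\<Union>\<C> = S - \<Inter>\<D>"
      using sub_compl by (auto simp: \<D>_def)
    ultimately show ?thesis by (auto simp: \<A>_def)
  qed
  obtain M where M: "M \<in> \<A>" "\<And>X. X \<in> \<A> \<Longrightarrow> M \<subseteq> X \<Longrightarrow> X = M"
    using subset_Zorn_nonempty[OF ne chain] by blast
  then obtain P where P: "M = S - P" "sub P" by (auto simp: \<A>_def)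
  have minimal: "Q = P" if "sub Q" "Q \<subseteq> P" for Q
  proof -
    have "S - Q = S - P" using M(2)[of "S - Q"] P that by (auto simp: \<A>_def)
    then show ?thesis using that P by (auto simp: sub_def)
  qed
  obtain e where e: "e \<in> P" using P by (auto simp: sub_def)
  have PS: "P \<subseteq> S" and Pcl: "\<And>x y. x \<in> P \<Longrightarrow> y \<in> P \<Longrightarrow> f x y \<in> P" and Pc: "compact P"
    using P by (auto simp: sub_def)
  have eS: "e \<in> S" using e PS by auto
  have contP: "continuous_on P (\<lambda>x. f x e)"
    using cont[OF eS] PS continuous_on_subset by blast
  have "sub ((\<lambda>x. f x e) ` P)"
  proof -
    have "f (f x e) (f y e) \<in> (\<lambda>x. f x e) ` P" if "x \<in> P" "y \<in> P" for x y
    proof -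
      have "f (f x e) (f y e) = f (f (f x e) y) e"
        using that e PS closed by (intro assoc[symmetric]) auto
      with that e Pcl show ?thesis by auto
    qed
    then show ?thesis
      unfolding sub_def using e PS Pcl compact_continuous_image[OF contP Pc] by auto
  qed
  then have "(\<lambda>x. f x e) ` P = P" using minimal e Pcl by blast
  then obtain p where p: "p \<in> P" "f p e = e" using e by (metis imageE)
  define Q where "Q = P \<inter> (\<lambda>x. f x e) -` {e}"
  have "compact Q"
  proof -
    have "closed Q" unfolding Q_def
      using continuous_on_closed_vimage[OF compact_imp_closed[OF Pc], of "\<lambda>x. f x e"] contP
      by (auto simp: Int_commute)
    moreover have "Q = P \<inter> Q" by (auto simp: Q_def)
    ultimately show ?thesis using Pc compact_Int_closed by metis
  qed
  moreover have "f x y \<in> Q" if "x \<in> Q" "y \<in> Q" for x y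
    using that Pcl assoc[of x y e] PS eS by (auto simp: Q_def subset_iff)
  ultimately have "sub Q" using p PS by (auto simp: sub_def Q_def)
  then have "Q = P" by (rule minimal) (auto simp: Q_def)
  with e have "f e e = e" by (auto simp: Q_def)
  with eS show ?thesis by blast
qed

section \<open>Simple algebras with non-negative structure constants\<close>

text \<open>
  The condition \<open>simple\<close> says that every basis element occurs in \<open>p j q\<close> for every \<open>j\<close> and suitable
  basis elements \<open>p\<close> and \<open>q\<close>. Countability of the index type makes the space of coefficient functions
  metrizable, hence Hausdorff.
\<close>

locale simple_nonneg_algebra =
  fixes J :: "'i::countable set" and c :: "'i \<Rightarrow> 'i \<Rightarrow> 'i \<Rightarrow> real"
  assumes finite_J: "finite J" and J_ne: "J \<noteq> {}"
    and c_nonneg: "\<lbrakk>i \<in> J; j \<in> J; k \<in> J\<rbrakk> \<Longrightarrow> c i j k \<ge> 0"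
    and c_assoc: "\<lbrakk>i \<in> J; j \<in> J; k \<in> J; l \<in> J\<rbrakk> \<Longrightarrow>
      (\<Sum>m\<in>J. c i j m * c m k l) = (\<Sum>m\<in>J. c j k m * c i m l)"
    and simple: "\<lbrakk>j \<in> J; k \<in> J\<rbrakk> \<Longrightarrow>
      \<exists>p\<in>J. \<exists>q\<in>J. \<exists>x\<in>J. c p j x > 0 \<and> c x q k > 0"
begin

definition mul :: "('i \<Rightarrow> real) \<Rightarrow> ('i \<Rightarrow> real) \<Rightarrow> 'i \<Rightarrow> real" where
  "mul x y = (\<lambda>k. if k \<in> J then \<Sum>i\<in>J. \<Sum>j\<in>J. x i * y j * c i j k else 0)"

definition total :: "('i \<Rightarrow> real) \<Rightarrow> real" where
  "total x = (\<Sum>i\<in>J. x i)"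

definition normalize :: "('i \<Rightarrow> real) \<Rightarrow> 'i \<Rightarrow> real" where
  "normalize x = (\<lambda>i. x i / total x)"

definition simplex :: "('i \<Rightarrow> real) set" where
  "simplex = {x. (\<forall>i. i \<notin> J \<longrightarrow> x i = 0) \<and> (\<forall>i\<in>J. x i \<ge> 0) \<and> total x = 1}"

definition sandwich :: "('i \<Rightarrow> real) \<Rightarrow> 'i \<Rightarrow> real" where
  "sandwich y = mul (mul (indicator J) y) (indicator J)"

lemma mul_scale_left: "mul (\<lambda>i. r * x i) y = (\<lambda>k. r * mul x y k)"
  by (auto simp: mul_def sum_distrib_left mult.assoc)

lemma mul_scale_right: "mul x (\<lambda>i. r * y i) = (\<lambda>k. r * mul x y k)"
  by (auto simp: mul_def sum_distrib_left mult_ac)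

text \<open>
  The sums run over \<open>J\<close> only, so associativity holds for all coefficient functions, including those
  that do not vanish outside \<open>J\<close>.
\<close>

lemma mul_assoc: "mul (mul x y) z = mul x (mul y z)"
proof
  fix l
  show "mul (mul x y) z l = mul x (mul y z) l"
  proof (cases "l \<in> J")
    case True
    have "mul (mul x y) z l = (\<Sum>m\<in>J. \<Sum>k\<in>J. \<Sum>i\<in>J. \<Sum>j\<in>J. x i * y j * z k * (c i j m * c m k l))"
      using True by (simp add: mul_def sum_distrib_right sum_distrib_left mult_ac cong: sum.cong)
    also have "\<dots> = (\<Sum>k\<in>J. \<Sum>m\<in>J. \<Sum>i\<in>J. \<Sum>j\<in>J. x i * y j * z k * (c i j m * c m k l))"
      by (rule sum.swap)
    also have "\<dots> = (\<Sum>k\<in>J. \<Sum>i\<in>J. \<Sum>m\<in>J. \<Sum>j\<in>J. x i * y j * z k * (c i j m * c m k l))"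
      by (intro sum.cong refl sum.swap)
    also have "\<dots> = (\<Sum>k\<in>J. \<Sum>i\<in>J. \<Sum>j\<in>J. \<Sum>m\<in>J. x i * y j * z k * (c i j m * c m k l))"
      by (intro sum.cong refl sum.swap)
    also have "\<dots> = (\<Sum>k\<in>J. \<Sum>i\<in>J. \<Sum>j\<in>J. x i * y j * z k * (\<Sum>m\<in>J. c j k m * c i m l))"
      using True by (intro sum.cong refl) (simp add: sum_distrib_left[symmetric] c_assoc)
    also have "\<dots> = (\<Sum>i\<in>J. \<Sum>k\<in>J. \<Sum>j\<in>J. x i * y j * z k * (\<Sum>m\<in>J. c j k m * c i m l))"
      by (rule sum.swap)
    also have "\<dots> = (\<Sum>i\<in>J. \<Sum>j\<in>J. \<Sum>k\<in>J. x i * y j * z k * (\<Sum>m\<in>J. c j k m * c i m l))"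
      by (intro sum.cong refl sum.swap)
    also have "\<dots> = (\<Sum>i\<in>J. \<Sum>j\<in>J. \<Sum>k\<in>J. \<Sum>m\<in>J. x i * (y j * z k * c j k m) * c i m l)"
      by (simp add: sum_distrib_left mult_ac)
    also have "\<dots> = (\<Sum>i\<in>J. \<Sum>j\<in>J. \<Sum>m\<in>J. \<Sum>k\<in>J. x i * (y j * z k * c j k m) * c i m l)"
      by (intro sum.cong refl sum.swap)
    also have "\<dots> = (\<Sum>i\<in>J. \<Sum>m\<in>J. \<Sum>j\<in>J. \<Sum>k\<in>J. x i * (y j * z k * c j k m) * c i m l)"
      by (intro sum.cong refl sum.swap)
    also have "\<dots> = mul x (mul y z) l"
      using True by (simp add: mul_def sum_distrib_right sum_distrib_left cong: sum.cong)
    finally show ?thesis .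
  qed (simp add: mul_def)
qed

lemma mul_nonneg:
  assumes "\<forall>i\<in>J. x i \<ge> 0" "\<forall>i\<in>J. y i \<ge> 0" "k \<in> J"
  shows "mul x y k \<ge> 0"
  using assms c_nonneg by (auto simp: mul_def intro!: sum_nonneg mult_nonneg_nonneg)

lemma mul_pos_term:
  assumes "\<forall>i\<in>J. x i \<ge> 0" "\<forall>i\<in>J. y i \<ge> 0" "k \<in> J"
    and "i \<in> J" "j \<in> J" "x i > 0" "y j > 0" "c i j k > 0"
  shows "mul x y k > 0"
proof -
  have "(\<Sum>j\<in>J. x i * y j * c i j k) > 0"
    using assms c_nonneg by (intro sum_pos2[OF finite_J \<open>j \<in> J\<close>]) auto
  then have "(\<Sum>i\<in>J. \<Sum>j\<in>J. x i * y j * c i j k) > 0"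
    using assms c_nonneg finite_J
    by - (rule sum_pos2[OF finite_J \<open>i \<in> J\<close>], auto intro!: sum_nonneg mult_nonneg_nonneg)
  with assms show ?thesis by (simp add: mul_def)
qed

lemma mul_pos:
  assumes "\<forall>i\<in>J. x i > 0" "\<forall>i\<in>J. y i > 0" "k \<in> J"
  shows "mul x y k > 0"
proof -
  obtain p q where "p \<in> J" "q \<in> J" "c p q k > 0"
    using simple[OF assms(3) assms(3)] by blast
  with assms show ?thesis by (intro mul_pos_term[of x y k p q]) (auto intro: less_imp_le)
qed

text \<open>
  This is where simplicity enters: the coefficient of \<open>u y u\<close> at \<open>k\<close> contains the positive
  contribution of some \<open>p j q\<close>, where \<open>y j > 0\<close>.
\<close>

lemma sandwich_pos:
  assumes "\<forall>i\<in>J. y i \<ge> 0" "total y > 0" "k \<in> J"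
  shows "sandwich y k > 0"
proof -
  obtain j where j: "j \<in> J" "y j > 0"
    using assms(2) sum_nonpos[of J y] by (force simp: total_def)
  obtain p q x where pqx: "p \<in> J" "q \<in> J" "x \<in> J" "c p j x > 0" "c x q k > 0"
    using simple[OF j(1) assms(3)] by blast
  have "mul (indicator J) y x > 0"
    using j pqx assms by (intro mul_pos_term[where i = p and j = j]) auto
  then show ?thesis
    unfolding sandwich_def using j pqx assms
    by - (rule mul_pos_term[where i = x and j = q], auto intro!: mul_nonneg)
qed

lemma total_pos: "\<forall>i\<in>J. x i > 0 \<Longrightarrow> total x > 0"
  using finite_J J_ne by (simp add: total_def sum_pos)

lemma normalize_in_simplex:
  assumes "\<forall>i\<in>J. x i \<ge> 0" "total x > 0" "\<forall>i. i \<notin> J \<longrightarrow> x i = 0"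
  shows "normalize x \<in> simplex"
  using assms by (auto simp: simplex_def normalize_def total_def simp flip: sum_divide_distrib)

lemma normalize_scale: "r \<noteq> 0 \<Longrightarrow> normalize (\<lambda>i. r * x i) = normalize x"
  by (auto simp: normalize_def total_def simp flip: sum_distrib_left)

lemma sandwich_scale: "sandwich (\<lambda>i. r * y i) = (\<lambda>k. r * sandwich y k)"
  by (simp add: sandwich_def mul_scale_left mul_scale_right)

lemma normalize_eq: "normalize x = (\<lambda>i. (1 / total x) * x i)"
  by (simp add: normalize_def)

lemma normalize_mul_left: "total x > 0 \<Longrightarrow> normalize (mul (normalize x) y) = normalize (mul x y)"
  unfolding normalize_eq[of x] by (subst mul_scale_left, rule normalize_scale) simp

lemma normalize_mul_right: "total y > 0 \<Longrightarrow> normalize (mul x (normalize y)) = normalize (mul x y)"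
  unfolding normalize_eq[of y] by (subst mul_scale_right, rule normalize_scale) simp

lemma normalize_sandwich: "total x > 0 \<Longrightarrow> normalize (sandwich (normalize x)) = normalize (sandwich x)"
  unfolding normalize_eq[of x] by (subst sandwich_scale, rule normalize_scale) simp

text \<open>
  The simplex is cut out by one closed condition from a product of the compact sets \<open>[0, 1]\<close> (over
  \<open>J\<close>) and \<open>{0}\<close>, and Tychonoff's theorem applies.
\<close>

lemma compact_simplex: "compact simplex"
proof -
  define B where "B i = (if i \<in> J then {0..1} else {0::real})" for i
  have "compactin (product_topology (\<lambda>i. euclidean) UNIV) (PiE UNIV B)"
    by (subst compactin_PiE) (auto simp: B_def)
  then have "compact (PiE UNIV B)"
    using euclidean_product_topology[where ?'a = 'i and ?'b = real] by simp
  moreover have "closed {x. total x = 1}"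
    unfolding total_def by (intro closed_Collect_eq continuous_intros) auto
  ultimately have "compact (PiE UNIV B \<inter> {x. total x = 1})"
    by (rule compact_Int_closed)
  moreover have "PiE UNIV B \<inter> {x. total x = 1} = simplex"
  proof -
    have "x i \<le> 1" if "x \<in> simplex" "i \<in> J" for x i
      using member_le_sum[of i J x] that finite_J by (auto simp: simplex_def total_def)
    then show ?thesis
      by (force simp: B_def simplex_def PiE_def Pi_def split: if_splits)
  qed
  ultimately show ?thesis by simp
qed

lemma continuous_on_mul:
  assumes "continuous_on T f" "continuous_on T g"
  shows "continuous_on T (\<lambda>x. mul (f x) (g x))"
proof (rule continuous_on_coordinatewise_then_product)
  fix k
  have "continuous_on T (\<lambda>x. f x i)" "continuous_on T (\<lambda>x. g x i)" for i
    using assms by (auto intro: continuous_on_product_then_coordinatewise)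
  then show "continuous_on T (\<lambda>x. mul (f x) (g x) k)"
    by (cases "k \<in> J") (auto simp: mul_def intro!: continuous_intros)
qed

lemma continuous_on_normalize:
  assumes "continuous_on T f" "\<And>x. x \<in> T \<Longrightarrow> total (f x) > 0"
  shows "continuous_on T (\<lambda>x. normalize (f x))"
proof (rule continuous_on_coordinatewise_then_product)
  fix k
  have "continuous_on T (\<lambda>x. f x i)" for i
    using assms by (auto intro: continuous_on_product_then_coordinatewise)
  moreover have "\<forall>x\<in>T. (\<Sum>i\<in>J. f x i) \<noteq> 0"
    using assms(2) by (force simp: total_def)
  ultimately show "continuous_on T (\<lambda>x. normalize (f x) k)"
    by (auto simp: normalize_def total_def intro!: continuous_intros)
qed

text \<open>
  The normalized elements \<open>u y u\<close>, with \<open>y\<close> in the simplex, form a compact semigroup under the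
  normalized product. Using \<open>u y u\<close> in place of the \<open>y\<close> themselves guarantees that products do not
  vanish, which would make normalization meaningless and discontinuous.
\<close>

theorem positive_quasi_idempotent:
  "\<exists>w \<mu>. (\<forall>i\<in>J. w i > 0) \<and> (\<forall>i. i \<notin> J \<longrightarrow> w i = 0) \<and> \<mu> > 0 \<and> mul w w = (\<lambda>i. \<mu> * w i)"
proof -
  define S where "S = (\<lambda>y. normalize (sandwich y)) ` simplex"
  define f where "f x y = normalize (mul x y)" for x y
  have simplexD: "\<forall>i\<in>J. y i \<ge> 0" "total y > 0" if "y \<in> simplex" for y
    using that by (auto simp: simplex_def)
  have sw: "\<forall>i\<in>J. sandwich y i > 0" if "y \<in> simplex" for y
    using sandwich_pos simplexD[OF that] by blast
  have sw_total: "total (sandwich y) > 0" if "y \<in> simplex" for y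
    using sw[OF that] by (rule total_pos)
  have off: "mul x y i = 0" if "i \<notin> J" for x y i
    using that by (simp add: mul_def)
  have Spos: "\<forall>i\<in>J. x i > 0" if "x \<in> S" for x
    using that sw sw_total by (auto simp: S_def normalize_def)
  have mul_total: "total (mul x y) > 0" if "x \<in> S" "y \<in> S" for x y
    using mul_pos Spos that by (intro total_pos) blast
  have "continuous_on simplex (\<lambda>y. normalize (sandwich y))"
    unfolding sandwich_def
    by (intro continuous_on_normalize continuous_on_mul continuous_intros)
       (use sw_total in \<open>auto simp: sandwich_def\<close>)
  then have "compact S" unfolding S_def
    by (rule compact_continuous_image[OF _ compact_simplex])
  moreover have "S \<noteq> {}"
  proof -
    have "normalize (indicator J) \<in> simplex"
      by (intro normalize_in_simplex total_pos) auto
    then show ?thesis by (auto simp: S_def)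
  qed
  moreover have "f x x' \<in> S" if "x \<in> S" "x' \<in> S" for x x'
  proof -
    obtain y y' where y: "y \<in> simplex" "x = normalize (sandwich y)"
      and y': "y' \<in> simplex" "x' = normalize (sandwich y')"
      using \<open>x \<in> S\<close> \<open>x' \<in> S\<close> by (auto simp: S_def)
    \<comment> \<open>Here \<open>(u y u)(u y' u) = u z u\<close>.\<close>
    define z where "z = mul y (mul (indicator J) (mul (indicator J) y'))"
    have eq: "mul (sandwich y) (sandwich y') = sandwich z"
      by (simp add: sandwich_def z_def mul_assoc)
    have z_nonneg: "\<forall>i\<in>J. z i \<ge> 0"
      unfolding z_def using simplexD(1)[OF y(1)] simplexD(1)[OF y'(1)]
      by (intro ballI mul_nonneg) auto
    have "total z > 0"
    proof (rule ccontr)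
      assume "\<not> total z > 0"
      with z_nonneg have "total z = 0" by (simp add: total_def sum_nonneg order_antisym)
      then have "\<forall>i\<in>J. z i = 0"
        using z_nonneg finite_J sum_nonneg_eq_0_iff[of J z] by (simp add: total_def)
      then have "sandwich z k = 0" for k
        by (simp add: sandwich_def mul_def)
      moreover obtain k where "k \<in> J" using J_ne by blast
      ultimately show False
        using mul_pos[OF sw[OF y(1)] sw[OF y'(1)], of k] eq by simp
    qed
    moreover have "f x x' = normalize (sandwich z)"
      using y y' sw_total by (simp add: f_def normalize_mul_left normalize_mul_right eq)
    moreover have "normalize z \<in> simplex"
      using z_nonneg \<open>total z > 0\<close> by (rule normalize_in_simplex) (simp add: z_def off)
    ultimately show ?thesis
      unfolding S_def by (metis imageI normalize_sandwich)
  qed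
  moreover have "f (f x y) z = f x (f y z)" if "x \<in> S" "y \<in> S" "z \<in> S" for x y z
    using that by (simp add: f_def normalize_mul_left normalize_mul_right mul_total mul_assoc)
  moreover have "continuous_on S (\<lambda>x. f x y)" if "y \<in> S" for y
    unfolding f_def using that mul_total
    by (intro continuous_on_normalize continuous_on_mul continuous_intros) auto
  ultimately obtain e where e: "e \<in> S" "f e e = e"
    using compact_semigroup_has_idempotent[of S f] by blast
  have "mul e e = (\<lambda>i. total (mul e e) * e i)"
  proof
    fix i
    have "e i = mul e e i / total (mul e e)"
      using e(2) by (metis f_def normalize_def)
    then show "mul e e i = total (mul e e) * e i"
      using mul_total[OF e(1) e(1)] by (simp add: field_simps)
  qed
  moreover have "\<forall>i. i \<notin> J \<longrightarrow> e i = 0"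
    using e(2) off by (metis f_def normalize_def div_0)
  ultimately show ?thesis using Spos[OF e(1)] mul_total[OF e(1) e(1)] by blast
qed

end

context positively_based_algebra
begin

section \<open>Real structure constants\<close>

text \<open>
  The unit of the algebra has index \<open>1\<close>, which is kept in this form.
\<close>

declare One_nat_def [simp del]

lemma \<iota>_zero: "\<iota> 0 = 0"
  using \<iota>_add[of 0 0] by simp

lemma \<iota>_sum: "\<iota> (\<Sum>k\<in>K. f k) = (\<Sum>k\<in>K. \<iota> (f k))"
  by (induction K rule: infinite_finite_induct) (auto simp: \<iota>_zero \<iota>_add)

lemma \<iota>_eq_0_iff: "\<iota> x = 0 \<longleftrightarrow> x = 0"
proof
  assume "\<iota> x = 0"
  then show "x = 0" using \<iota>_mult[of x "inverse x"] \<iota>_one by (cases "x = 0") auto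
qed (simp add: \<iota>_zero)

lemma real_const_nonneg: "\<lbrakk>i \<in> {1..n}; j \<in> {1..n}; k \<in> {1..n}\<rbrakk> \<Longrightarrow> real_const i j k \<ge> 0"
  using \<gamma>_nonneg[of i j k] by (auto simp: real_const_def elim!: nonneg_Reals_cases)

lemma \<iota>_\<gamma>: "\<lbrakk>i \<in> {1..n}; j \<in> {1..n}; k \<in> {1..n}\<rbrakk> \<Longrightarrow> \<iota> (\<gamma> i j k) = of_real (real_const i j k)"
  using \<gamma>_nonneg[of i j k] by (auto simp: real_const_def elim!: nonneg_Reals_cases)

lemma \<gamma>_eq_0_iff:
  "\<lbrakk>i \<in> {1..n}; j \<in> {1..n}; k \<in> {1..n}\<rbrakk> \<Longrightarrow> \<gamma> i j k = 0 \<longleftrightarrow> k \<notin> star i j"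
  using \<iota>_\<gamma>[of i j k] \<iota>_eq_0_iff[of "\<gamma> i j k"] real_const_nonneg[of i j k]
  by (auto simp: star_def)

lemma basis_coeffs_unique:
  assumes "(\<Sum>k\<in>{1..n}. f k *s a k) = (\<Sum>k\<in>{1..n}. g k *s a k)" "k \<in> {1..n}"
  shows "f k = g k"
proof -
  define u where "u v = (f - g) (the_inv_into {1..n} a v)" for v
  have "(\<Sum>v\<in>a ` {1..n}. u v *s v) = (\<Sum>k\<in>{1..n}. (f k - g k) *s a k)"
    by (subst sum.reindex[OF basis_inj])
       (simp add: u_def the_inv_into_f_f[OF basis_inj] del: atLeastAtMost_iff cong: sum.cong)
  also have "\<dots> = 0"
    using assms(1) by (simp add: scale_left_diff_distrib sum_subtractf)
  finally have "\<forall>v\<in>a ` {1..n}. u v = 0"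
    using basis_independent dependent_finite[of "a ` {1..n}"] by blast
  then have "u (a k) = 0" using assms(2) by blast
  then show ?thesis
    using assms(2) by (simp add: u_def the_inv_into_f_f[OF basis_inj])
qed

text \<open>
  Associativity in \<open>A\<close> is compared coefficientwise, and the resulting identity is transported along
  the embedding \<open>\<iota>\<close>.
\<close>

lemma real_const_assoc:
  assumes "i \<in> {1..n}" "j \<in> {1..n}" "k \<in> {1..n}" "l \<in> {1..n}"
  shows "(\<Sum>m\<in>{1..n}. real_const i j m * real_const m k l)
       = (\<Sum>m\<in>{1..n}. real_const j k m * real_const i m l)"
proof -
  have "a i * a j * a k = (\<Sum>m\<in>{1..n}. \<gamma> i j m *s (\<Sum>l\<in>{1..n}. \<gamma> m k l *s a l))"
    using assms by (simp add: basis_mult sum_distrib_right scale_mult_left)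
  also have "\<dots> = (\<Sum>l\<in>{1..n}. (\<Sum>m\<in>{1..n}. \<gamma> i j m * \<gamma> m k l) *s a l)"
    by (simp add: scale_sum_right scale_sum_left, rule sum.swap)
  finally have 1: "a i * a j * a k = (\<Sum>l\<in>{1..n}. (\<Sum>m\<in>{1..n}. \<gamma> i j m * \<gamma> m k l) *s a l)" .
  have "a i * (a j * a k) = (\<Sum>m\<in>{1..n}. \<gamma> j k m *s (\<Sum>l\<in>{1..n}. \<gamma> i m l *s a l))"
    using assms by (simp add: basis_mult sum_distrib_left scale_mult_right)
  also have "\<dots> = (\<Sum>l\<in>{1..n}. (\<Sum>m\<in>{1..n}. \<gamma> j k m * \<gamma> i m l) *s a l)"
    by (simp add: scale_sum_right scale_sum_left, rule sum.swap)
  finally have "(\<Sum>m\<in>{1..n}. \<gamma> i j m * \<gamma> m k l) = (\<Sum>m\<in>{1..n}. \<gamma> j k m * \<gamma> i m l)"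
    using 1 by (intro basis_coeffs_unique assms) (simp add: mult.assoc)
  then have "\<iota> (\<Sum>m\<in>{1..n}. \<gamma> i j m * \<gamma> m k l) = \<iota> (\<Sum>m\<in>{1..n}. \<gamma> j k m * \<gamma> i m l)"
    by simp
  then have "complex_of_real (\<Sum>m\<in>{1..n}. real_const i j m * real_const m k l)
           = complex_of_real (\<Sum>m\<in>{1..n}. real_const j k m * real_const i m l)"
    using assms by (simp add: \<iota>_sum \<iota>_mult \<iota>_\<gamma> of_real_sum del: atLeastAtMost_iff cong: sum.cong)
  then show ?thesis by (simp only: of_real_eq_iff)
qed

lemma \<gamma>_unit:
  assumes "i \<in> {1..n}" "k \<in> {1..n}"
  shows "\<gamma> 1 i k = (if k = i then 1 else 0)" "\<gamma> i 1 k = (if k = i then 1 else 0)"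
proof -
  have 1: "1 \<in> {1..n}" using n_pos by simp
  have e: "a i = (\<Sum>k\<in>{1..n}. (if k = i then 1 else 0) *s a k)"
    using assms(1) by (simp add: if_distrib[of "\<lambda>c. c *s _"] sum.delta cong: if_cong)
  have "(\<Sum>k\<in>{1..n}. \<gamma> 1 i k *s a k) = a i"
    using basis_mult[OF 1 assms(1)] by (simp add: basis_unit)
  with e show "\<gamma> 1 i k = (if k = i then 1 else 0)"
    using basis_coeffs_unique[OF _ assms(2), of "\<gamma> 1 i" "\<lambda>k. if k = i then 1 else 0"] by simp
  have "(\<Sum>k\<in>{1..n}. \<gamma> i 1 k *s a k) = a i"
    using basis_mult[OF assms(1) 1] by (simp add: basis_unit)
  with e show "\<gamma> i 1 k = (if k = i then 1 else 0)"
    using basis_coeffs_unique[OF _ assms(2), of "\<gamma> i 1" "\<lambda>k. if k = i then 1 else 0"] by simp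
qed

lemma real_const_unit_right:
  "\<lbrakk>i \<in> {1..n}; k \<in> {1..n}\<rbrakk> \<Longrightarrow> real_const i 1 k = (if k = i then 1 else 0)"
  by (simp add: real_const_def \<gamma>_unit \<iota>_one \<iota>_zero)

section \<open>The multi-valued product on indices\<close>

lemma star_subset: "k \<in> star i j \<Longrightarrow> k \<in> {1..n}"
  by (simp add: star_def)

lemma one_mem: "1 \<in> {1..n}"
  using n_pos by simp

lemma star_one: "i \<in> {1..n} \<Longrightarrow> star 1 i = {i}" "i \<in> {1..n} \<Longrightarrow> star i 1 = {i}"
  by (auto simp: star_def real_const_def \<gamma>_unit \<iota>_one \<iota>_zero split: if_splits)

text \<open>
  A sum of products of non-negative numbers is positive exactly if one of the products is. So no
  cancellation occurs, and associativity of the structure constants passes to their supports.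
\<close>

lemma star_assoc:
  assumes "i \<in> {1..n}" "j \<in> {1..n}" "k \<in> {1..n}"
  shows "(\<exists>x\<in>star i j. y \<in> star x k) \<longleftrightarrow> (\<exists>x\<in>star j k. y \<in> star i x)"
proof (cases "y \<in> {1..n}")
  case True
  have pos_iff: "(\<exists>x\<in>{1..n}. f x > 0 \<and> g x > 0) \<longleftrightarrow> (\<Sum>x\<in>{1..n}. f x * g x) > 0"
    if "\<And>x. x \<in> {1..n} \<Longrightarrow> f x \<ge> 0" "\<And>x. x \<in> {1..n} \<Longrightarrow> g x \<ge> 0" for f g :: "nat \<Rightarrow> real"
  proof
    assume "\<exists>x\<in>{1..n}. f x > 0 \<and> g x > 0"
    then obtain x where "x \<in> {1..n}" "f x > 0" "g x > 0" by blast
    then show "(\<Sum>x\<in>{1..n}. f x * g x) > 0"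
      using that by (intro sum_pos2[OF finite_atLeastAtMost \<open>x \<in> {1..n}\<close>] mult_pos_pos mult_nonneg_nonneg)
  next
    assume "(\<Sum>x\<in>{1..n}. f x * g x) > 0"
    then have "(\<Sum>x\<in>{1..n}. f x * g x) \<noteq> 0" by simp
    then obtain x where x: "x \<in> {1..n}" "f x * g x \<noteq> 0"
      by (rule sum.not_neutral_contains_not_neutral)
    then have "f x > 0 \<and> g x > 0"
      using that(1)[OF x(1)] that(2)[OF x(1)] by auto
    with x(1) show "\<exists>x\<in>{1..n}. f x > 0 \<and> g x > 0" by blast
  qed
  have "(\<exists>x\<in>star i j. y \<in> star x k)
      \<longleftrightarrow> (\<exists>x\<in>{1..n}. real_const i j x > 0 \<and> real_const x k y > 0)"
    using True by (auto simp: star_def)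
  also have "\<dots> \<longleftrightarrow> (\<exists>x\<in>{1..n}. real_const j k x > 0 \<and> real_const i x y > 0)"
    using assms True real_const_assoc[of i j k y]
    by (simp only: pos_iff[OF real_const_nonneg real_const_nonneg])
  also have "\<dots> \<longleftrightarrow> (\<exists>x\<in>star j k. y \<in> star i x)"
    using True by (auto simp: star_def)
  finally show ?thesis .
qed (auto simp: star_def)

lemma star_assocE:
  assumes "x \<in> star i j" "y \<in> star x k" "i \<in> {1..n}" "j \<in> {1..n}" "k \<in> {1..n}"
  obtains x' where "x' \<in> star j k" "y \<in> star i x'"
  using star_assoc[of i j k y] assms by blast

lemma star_assocE':
  assumes "x \<in> star j k" "y \<in> star i x" "i \<in> {1..n}" "j \<in> {1..n}" "k \<in> {1..n}"
  obtains x' where "x' \<in> star i j" "y \<in> star x' k"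
  using star_assoc[of i j k y] assms by blast

lemma le_L_mem: "le_L i j \<Longrightarrow> i \<in> {1..n} \<and> j \<in> {1..n}"
  by (auto simp: le_L_def star_def)

lemma le_L_refl: "i \<in> {1..n} \<Longrightarrow> le_L i i"
  using one_mem star_one(1)[of i] unfolding le_L_def by blast

lemma le_L_trans:
  assumes "le_L i j" "le_L j k"
  shows "le_L i k"
proof -
  obtain s t where "s \<in> {1..n}" "j \<in> star s i" "t \<in> {1..n}" "k \<in> star t j" "i \<in> {1..n}"
    using assms by (auto simp: le_L_def)
  moreover from this obtain x where "x \<in> star t s" "k \<in> star x i"
    using star_assocE'[of j s i k t] by blast
  ultimately show ?thesis
    using star_subset unfolding le_L_def by blast
qed

lemma le_L_star: "\<lbrakk>s \<in> {1..n}; i \<in> {1..n}; j \<in> star s i\<rbrakk> \<Longrightarrow> le_L i j"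
  by (auto simp: le_L_def)

lemma le_J_iff:
  "le_J i j \<longleftrightarrow> i \<in> {1..n} \<and> (\<exists>s\<in>{1..n}. \<exists>t\<in>{1..n}. \<exists>x\<in>star s i. j \<in> star x t)"
  by (auto simp: le_J_def star_set_def)

lemma le_J_mem: "le_J i j \<Longrightarrow> i \<in> {1..n} \<and> j \<in> {1..n}"
  by (auto simp: le_J_iff star_def)

lemma le_J_star_left:
  assumes "i \<in> {1..n}" "j \<in> {1..n}" "k \<in> star i j"
  shows "le_J i k"
  using assms one_mem star_one(1)[OF assms(1)] unfolding le_J_iff by blast

lemma le_J_star_right:
  assumes "i \<in> {1..n}" "j \<in> {1..n}" "k \<in> star i j"
  shows "le_J j k"
proof -
  have "k \<in> star k 1" using star_one(2)[of k] star_subset[OF assms(3)] by simp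
  then show ?thesis using assms one_mem unfolding le_J_iff by blast
qed

lemma le_J_refl: "i \<in> {1..n} \<Longrightarrow> le_J i i"
  using le_J_star_left[OF _ one_mem, of i i] star_one(2)[of i] by simp

lemma le_J_trans:
  assumes "le_J i j" "le_J j k"
  shows "le_J i k"
proof -
  obtain s t x where 1: "s \<in> {1..n}" "t \<in> {1..n}" "x \<in> star s i" "j \<in> star x t" "i \<in> {1..n}"
    using assms(1) by (auto simp: le_J_iff)
  obtain s' t' y where 2: "s' \<in> {1..n}" "t' \<in> {1..n}" "y \<in> star s' j" "k \<in> star y t'"
    using assms(2) by (auto simp: le_J_iff)
  have x: "x \<in> {1..n}" using 1 star_subset by blast
  obtain z where z: "z \<in> star s' x" "y \<in> star z t"
    using star_assocE'[OF 1(4) 2(3) 2(1) x 1(2)] by blast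
  obtain p where p: "p \<in> star s' s" "z \<in> star p i"
    using star_assocE'[OF 1(3) z(1) 2(1) 1(1) 1(5)] by blast
  obtain q where "q \<in> star t t'" "k \<in> star z q"
    using star_assocE[OF z(2) 2(4) star_subset[OF z(1)] 1(2) 2(2)] by blast
  moreover from this have "q \<in> {1..n}" using star_subset by blast
  moreover have "p \<in> {1..n}" using p star_subset by blast
  ultimately show ?thesis using p(2) 1(5) unfolding le_J_iff by blast
qed

lemma left_cellE:
  assumes "L \<in> left_cells"
  obtains i where "i \<in> {1..n}" "L = {j. le_L i j \<and> le_L j i}"
  using assms by (auto simp: left_cells_def quotient_def)

lemma two_sided_cellE:
  assumes "J \<in> two_sided_cells"
  obtains i where "i \<in> {1..n}" "J = {j. le_J i j \<and> le_J j i}"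
  using assms by (auto simp: two_sided_cells_def quotient_def)

lemma two_sided_cellI: "i \<in> {1..n} \<Longrightarrow> {j. le_J i j \<and> le_J j i} \<in> two_sided_cells"
  by (auto simp: two_sided_cells_def quotient_def)

lemma left_cellI: "i \<in> {1..n} \<Longrightarrow> {j. le_L i j \<and> le_L j i} \<in> left_cells"
  by (auto simp: left_cells_def quotient_def)

lemma left_cellD:
  assumes "L \<in> left_cells"
  shows "L \<subseteq> {1..n}" "L \<noteq> {}" "\<lbrakk>i \<in> L; j \<in> L\<rbrakk> \<Longrightarrow> le_L i j"
    "\<lbrakk>i \<in> L; j \<in> L; le_L i k; le_L k j\<rbrakk> \<Longrightarrow> k \<in> L"
proof -
  obtain z where z: "z \<in> {1..n}" "L = {j. le_L z j \<and> le_L j z}" using assms by (rule left_cellE)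
  show "L \<subseteq> {1..n}" "L \<noteq> {}" using z le_L_mem le_L_refl by blast+
  show "\<lbrakk>i \<in> L; j \<in> L\<rbrakk> \<Longrightarrow> le_L i j" "\<lbrakk>i \<in> L; j \<in> L; le_L i k; le_L k j\<rbrakk> \<Longrightarrow> k \<in> L"
    using z le_L_trans by blast+
qed

lemma two_sided_cellD:
  assumes "J \<in> two_sided_cells"
  shows "J \<subseteq> {1..n}" "J \<noteq> {}" "\<lbrakk>i \<in> J; j \<in> J\<rbrakk> \<Longrightarrow> le_J i j"
    "\<lbrakk>i \<in> J; j \<in> J; le_J i k; le_J k j\<rbrakk> \<Longrightarrow> k \<in> J"
proof -
  obtain z where z: "z \<in> {1..n}" "J = {j. le_J z j \<and> le_J j z}" using assms by (rule two_sided_cellE)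
  show "J \<subseteq> {1..n}" "J \<noteq> {}" using z le_J_mem le_J_refl by blast+
  show "\<lbrakk>i \<in> J; j \<in> J\<rbrakk> \<Longrightarrow> le_J i j" "\<lbrakk>i \<in> J; j \<in> J; le_J i k; le_J k j\<rbrakk> \<Longrightarrow> k \<in> J"
    using z le_J_trans by blast+
qed

section \<open>The apex of a cell module\<close>

lemma up_closure_eq:
  assumes "L \<in> left_cells"
  shows "up_closure L = {j. \<exists>i\<in>L. le_L i j}"
proof
  show "up_closure L \<subseteq> {j. \<exists>i\<in>L. le_L i j}"
    using left_cellD(3) le_L_trans unfolding up_closure_def left_cell_le_def by blast
  show "{j. \<exists>i\<in>L. le_L i j} \<subseteq> up_closure L"
  proof
    fix j assume "j \<in> {j. \<exists>i\<in>L. le_L i j}"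
    then obtain i where i: "i \<in> L" "le_L i j" by blast
    then have "j \<in> {1..n}" using le_L_mem by blast
    then have "j \<in> {k. le_L j k \<and> le_L k j}" "{k. le_L j k \<and> le_L k j} \<in> left_cells"
      using le_L_refl left_cellI by auto
    with i show "j \<in> up_closure L" unfolding up_closure_def left_cell_le_def by blast
  qed
qed

lemma coefficient_zero_of_span:
  assumes "T \<subseteq> {1..n}" "(\<Sum>k\<in>{1..n}. f k *s a k) \<in> span (a ` T)" "k \<in> {1..n} - T"
  shows "f k = 0"
proof -
  have "finite T" using assms(1) finite_subset by blast
  then obtain u where "(\<Sum>k\<in>{1..n}. f k *s a k) = (\<Sum>v\<in>a ` T. u v *s v)"
    using assms(2) by (auto simp: span_finite)
  also have "\<dots> = (\<Sum>k\<in>T. u (a k) *s a k)"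
    using inj_on_subset[OF basis_inj assms(1)] by (simp add: sum.reindex)
  also have "\<dots> = (\<Sum>k\<in>{1..n}. (if k \<in> T then u (a k) else 0) *s a k)"
    using assms(1) by (intro sum.mono_neutral_cong_left) auto
  finally show ?thesis
    using basis_coeffs_unique assms(3) by fastforce
qed

lemma basis_mult_in_span:
  assumes "i \<in> {1..n}" "j \<in> {1..n}" "star i j \<subseteq> T"
  shows "a i * a j \<in> span (a ` T)"
proof -
  have "a i * a j = (\<Sum>k\<in>{1..n}. \<gamma> i j k *s a k)" using basis_mult assms by blast
  also have "\<dots> \<in> span (a ` T)"
  proof (rule span_sum)
    fix k assume k: "k \<in> {1..n}"
    show "\<gamma> i j k *s a k \<in> span (a ` T)"
    proof (cases "k \<in> star i j")
      case True
      then show ?thesis using assms(3) by (intro span_scale span_base) auto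
    next
      case False
      then have "\<gamma> i j k = 0" using \<gamma>_eq_0_iff[OF assms(1,2) k] by simp
      then show ?thesis by (simp add: span_zero)
    qed
  qed
  finally show ?thesis .
qed

lemma mult_span_subset:
  assumes "\<And>j. j \<in> T \<Longrightarrow> b * a j \<in> span (a ` U)" "x \<in> span (a ` T)"
  shows "b * x \<in> span (a ` U)"
  using assms(2)
proof (induction x rule: span_induct_alt)
  case base
  then show ?case by (simp add: span_zero)
next
  case (step r v y)
  then show ?case
    using assms(1) by (auto simp: distrib_left scale_mult_right intro!: span_add span_scale)
qed

text \<open>
  On the quotient \<open>C\<^sub>L\<close>, which has a basis indexed by \<open>L\<close>, the matrix entries of \<open>a i\<close> are the
  structure constants \<open>\<gamma> i j k\<close> with \<open>j\<close> and \<open>k\<close> in \<open>L\<close>. Hence \<open>a i\<close> acts by zero exactly if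
  all of these vanish.
\<close>

lemma annihilates_cell_module_iff:
  assumes L: "L \<in> left_cells" and i: "i \<in> {1..n}"
  shows "annihilates_cell_module (a i) L \<longleftrightarrow> (\<forall>j\<in>L. star i j \<inter> L = {})"
proof -
  let ?U = "up_closure L"
  have U: "?U \<subseteq> {1..n}" using up_closure_eq[OF L] le_L_mem by blast
  have LU: "L \<subseteq> ?U" using up_closure_eq[OF L] left_cellD(1)[OF L] le_L_refl by blast
  have up: "star i j \<subseteq> ?U" if "j \<in> ?U" for j
    using that le_L_star[OF i] U le_L_trans unfolding up_closure_eq[OF L] by blast
  have low: "star i j \<subseteq> ?U - L" if "j \<in> ?U - L" for j
  proof -
    have "k \<notin> L" if k: "k \<in> star i j" for k
    proof
      assume "k \<in> L"
      moreover have "le_L j k" using le_L_star[OF i _ k] U \<open>j \<in> ?U - L\<close> by blast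
      moreover obtain l where "l \<in> L" "le_L l j"
        using \<open>j \<in> ?U - L\<close> up_closure_eq[OF L] by blast
      ultimately have "j \<in> L" using left_cellD(4)[OF L] by blast
      with \<open>j \<in> ?U - L\<close> show False by blast
    qed
    with up that show ?thesis by blast
  qed
  have low_sub: "a i * y \<in> lower_submodule L" if "y \<in> lower_submodule L" for y
  proof -
    have "a i * a j \<in> span (a ` (?U - L))" if "j \<in> ?U - L" for j
      using that U by (intro basis_mult_in_span i low) auto
    then show ?thesis
      using that unfolding lower_submodule_def by (rule mult_span_subset)
  qed
  show ?thesis
  proof
    assume ann: "annihilates_cell_module (a i) L"
    show "\<forall>j\<in>L. star i j \<inter> L = {}"
    proof (rule ballI, rule ccontr)
      fix j assume j: "j \<in> L" "star i j \<inter> L \<noteq> {}"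
      then obtain k where k: "k \<in> star i j" "k \<in> L" by blast
      have jn: "j \<in> {1..n}" using j left_cellD(1)[OF L] by blast
      let ?X = "(\<lambda>y. a j + y) ` lower_submodule L"
      have "a j \<in> upper_submodule L"
        using j LU unfolding upper_submodule_def by (intro span_base) auto
      then have "?X \<in> cell_module L" by (auto simp: cell_module_def)
      then have "cell_module_act L (a i) ?X = lower_submodule L"
        using ann by (auto simp: annihilates_cell_module_def)
      moreover have "0 \<in> lower_submodule L" by (simp add: lower_submodule_def span_zero)
      then have "a i * a j \<in> cell_module_act L (a i) ?X"
        unfolding cell_module_act_def
        by (intro CollectI exI[of _ "a j"] exI[of _ 0]) (auto intro!: rev_image_eqI[of 0])
      ultimately have "(\<Sum>k\<in>{1..n}. \<gamma> i j k *s a k) \<in> span (a ` (?U - L))"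
        using basis_mult[OF i jn] by (simp add: lower_submodule_def)
      then have "\<gamma> i j k = 0"
        using U k star_subset by (intro coefficient_zero_of_span[of "?U - L"]) auto
      then show False using \<gamma>_eq_0_iff[OF i jn] k star_subset by blast
    qed
  next
    assume none: "\<forall>j\<in>L. star i j \<inter> L = {}"
    have kill: "a i * x \<in> lower_submodule L" if "x \<in> upper_submodule L" for x
    proof -
      have "star i j \<subseteq> ?U - L" if "j \<in> ?U" for j
        using that none up low by blast
      then have "a i * a j \<in> span (a ` (?U - L))" if "j \<in> ?U" for j
        using that U by (intro basis_mult_in_span i) auto
      then show ?thesis
        using that unfolding lower_submodule_def upper_submodule_def
        by (rule mult_span_subset)
    qed
    have add: "u + v \<in> lower_submodule L" "u - v \<in> lower_submodule L"
      if "u \<in> lower_submodule L" "v \<in> lower_submodule L" for u v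
      using that by (auto simp: lower_submodule_def span_add span_diff)
    have zero: "0 \<in> lower_submodule L" by (simp add: lower_submodule_def span_zero)
    have "cell_module_act L (a i) ((\<lambda>y. x + y) ` lower_submodule L) = lower_submodule L"
      if x: "x \<in> upper_submodule L" for x
    proof
      show "cell_module_act L (a i) ((\<lambda>y. x + y) ` lower_submodule L) \<subseteq> lower_submodule L"
        unfolding cell_module_act_def using kill[OF x] low_sub add
        by (auto simp: distrib_left)
      show "lower_submodule L \<subseteq> cell_module_act L (a i) ((\<lambda>y. x + y) ` lower_submodule L)"
      proof
        fix z assume "z \<in> lower_submodule L"
        then have "z - a i * x \<in> lower_submodule L" using add kill[OF x] by blast
        moreover have "x \<in> (\<lambda>y. x + y) ` lower_submodule L"
          using zero by (auto intro!: rev_image_eqI[of 0])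
        ultimately show "z \<in> cell_module_act L (a i) ((\<lambda>y. x + y) ` lower_submodule L)"
          unfolding cell_module_act_def
          by (intro CollectI exI[of _ x] exI[of _ "z - a i * x"]) auto
      qed
    qed
    then show "annihilates_cell_module (a i) L"
      by (auto simp: annihilates_cell_module_def cell_module_def)
  qed
qed

text \<open>
  Since \<open>k\<close> and \<open>j'\<close> lie in the same left cell, some \<open>s\<close> leads from \<open>k\<close> to \<open>j'\<close>. So \<open>i'\<close> after \<open>s\<close>
  after \<open>i\<close> leads from \<open>j\<close> to \<open>k'\<close>, and associativity regroups this as the action of a single index
  in \<open>i' \<star> s \<star> i\<close>.
\<close>

lemma acting_sandwich:
  assumes L: "L \<in> left_cells"
    and i: "i \<in> {1..n}" "j \<in> L" "k \<in> star i j" "k \<in> L"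
    and i': "i' \<in> {1..n}" "j' \<in> L" "k' \<in> star i' j'" "k' \<in> L"
  obtains s p m where "s \<in> {1..n}" "p \<in> star i' s" "m \<in> star p i" "k' \<in> star m j"
proof -
  have jn: "j \<in> {1..n}" "j' \<in> {1..n}" "k \<in> {1..n}"
    using i i' left_cellD(1)[OF L] by auto
  obtain s where s: "s \<in> {1..n}" "j' \<in> star s k"
    using left_cellD(3)[OF L i(4) i'(2)] by (auto simp: le_L_def)
  obtain p where p: "p \<in> star i' s" "k' \<in> star p k"
    using star_assocE'[OF s(2) i'(3) i'(1) s(1) jn(3)] by blast
  obtain m where m: "m \<in> star p i" "k' \<in> star m j"
    using star_assocE'[OF i(3) p(2) star_subset[OF p(1)] i(1) jn(1)] by blast
  show thesis by (rule that[OF s(1) p(1) m])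
qed

lemma finite_directed_has_greatest:
  assumes "finite A" "A \<noteq> {}" "A \<subseteq> {1..n}"
    and "\<And>x y. x \<in> A \<Longrightarrow> y \<in> A \<Longrightarrow> \<exists>z\<in>A. le_J x z \<and> le_J y z"
  shows "\<exists>z\<in>A. \<forall>x\<in>A. le_J x z"
proof -
  have "\<exists>z\<in>A. \<forall>x\<in>F. le_J x z" if "finite F" "F \<noteq> {}" "F \<subseteq> A" for F
    using that
  proof (induction F rule: finite_ne_induct)
    case (singleton x)
    then show ?case using assms(3) le_J_refl by blast
  next
    case (insert x F)
    then obtain z where z: "z \<in> A" "\<forall>x\<in>F. le_J x z" by auto
    have "x \<in> A" using insert.prems by simp
    then obtain z' where z': "z' \<in> A" "le_J x z'" "le_J z z'" using assms(4) z(1) by blast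
    then have "\<forall>y\<in>insert x F. le_J y z'" using z(2) le_J_trans by blast
    with z'(1) show ?case by blast
  qed
  from this[OF assms(1,2) subset_refl] show ?thesis .
qed

text \<open>
  Directedness of the set \<open>N\<close> of acting indices gives a greatest one, \<open>m\<close>, and the cell of \<open>m\<close> is the
  apex. Some element of \<open>m \<star> s \<star> m\<close> acts as well; it lies above \<open>m\<close>, hence in the cell of \<open>m\<close>, and
  so does its left factor in \<open>m \<star> s\<close>. This exhibits a product of two elements of the apex that
  meets the apex.
\<close>

lemma apex_properties:
  assumes L: "L \<in> left_cells"
  shows "apex L \<in> two_sided_cells" "\<exists>p\<in>apex L. \<exists>q\<in>apex L. star p q \<inter> apex L \<noteq> {}"
proof -
  define N where "N = {i \<in> {1..n}. \<exists>j\<in>L. \<exists>k\<in>L. k \<in> star i j}"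
  have nac: "nonannihilating_cells L = {J \<in> two_sided_cells. J \<inter> N \<noteq> {}}"
  proof -
    have "\<not> annihilates_cell_module (a i) L \<longleftrightarrow> i \<in> N" if "i \<in> {1..n}" for i
      using annihilates_cell_module_iff[OF L that] that unfolding N_def by blast
    then have "(\<exists>i\<in>J. \<not> annihilates_cell_module (a i) L) \<longleftrightarrow> J \<inter> N \<noteq> {}"
      if "J \<in> two_sided_cells" for J
      using two_sided_cellD(1)[OF that] by blast
    then show ?thesis unfolding nonannihilating_cells_def by blast
  qed
  have Nfin: "finite N" and "N \<subseteq> {1..n}" by (auto simp: N_def)
  have "1 \<in> N"
  proof -
    obtain j where j: "j \<in> L" using left_cellD(2)[OF L] by blast
    then have "j \<in> star 1 j" using left_cellD(1)[OF L] star_one(1)[of j] by blast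
    with j show ?thesis using one_mem unfolding N_def by blast
  qed
  then have Nne: "N \<noteq> {}" by blast
  have sandwich: "\<exists>z\<in>N. \<exists>s\<in>{1..n}. \<exists>p\<in>star y s. z \<in> star p x"
    if xN: "x \<in> N" and yN: "y \<in> N" for x y
  proof -
    have xn: "x \<in> {1..n}" and yn: "y \<in> {1..n}" using xN yN \<open>N \<subseteq> {1..n}\<close> by blast+
    obtain j k where x: "j \<in> L" "k \<in> star x j" "k \<in> L"
      using xN unfolding N_def by blast
    obtain j' k' where y: "j' \<in> L" "k' \<in> star y j'" "k' \<in> L"
      using yN unfolding N_def by blast
    obtain s p m where "s \<in> {1..n}" "p \<in> star y s" "m \<in> star p x" "k' \<in> star m j"
      using acting_sandwich[OF L xn x yn y] by blast
    moreover from this have "m \<in> N"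
      using x(1) y(3) star_subset[of m p x] unfolding N_def by blast
    ultimately show ?thesis by blast
  qed
  have le_sandwich: "le_J x z \<and> le_J y z \<and> le_J y p \<and> le_J p z"
    if "x \<in> N" "y \<in> N" "s \<in> {1..n}" "p \<in> star y s" "z \<in> star p x" for x y s p z
  proof -
    have "x \<in> {1..n}" "y \<in> {1..n}" "p \<in> {1..n}"
      using that \<open>N \<subseteq> {1..n}\<close> star_subset by blast+
    then have "le_J y p" "le_J p z" "le_J x z"
      using that le_J_star_left le_J_star_right by blast+
    then show ?thesis using le_J_trans by blast
  qed
  have "\<exists>z\<in>N. le_J x z \<and> le_J y z" if xy: "x \<in> N" "y \<in> N" for x y
    using sandwich[OF xy] le_sandwich[OF xy] by blast
  then have "\<exists>z\<in>N. \<forall>x\<in>N. le_J x z"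
    by (rule finite_directed_has_greatest[OF Nfin Nne \<open>N \<subseteq> {1..n}\<close>])
  then obtain m where m: "m \<in> N" "\<And>x. x \<in> N \<Longrightarrow> le_J x m" by blast
  define J where "J = {j. le_J m j \<and> le_J j m}"
  have mn: "m \<in> {1..n}" using m \<open>N \<subseteq> {1..n}\<close> by blast
  have J: "J \<in> two_sided_cells" "m \<in> J"
    using two_sided_cellI[OF mn] le_J_refl[OF mn] by (auto simp: J_def)
  have "apex L = J"
    unfolding apex_def
  proof (rule the_equality)
    show "J \<in> nonannihilating_cells L \<and> (\<forall>J'\<in>nonannihilating_cells L. two_sided_cell_le J' J)"
      using J m unfolding nac two_sided_cell_le_def by blast
    fix K
    assume K: "K \<in> nonannihilating_cells L \<and> (\<forall>J'\<in>nonannihilating_cells L. two_sided_cell_le J' K)"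
    then have Kc: "K \<in> two_sided_cells" by (simp add: nac)
    obtain x where x: "x \<in> K" "x \<in> N" using K by (auto simp: nac)
    have "two_sided_cell_le J K" using K J m nac by blast
    then obtain u v where uv: "u \<in> J" "v \<in> K" "le_J u v" by (auto simp: two_sided_cell_le_def)
    have mx: "le_J m x" using uv two_sided_cellD(3)[OF Kc uv(2) x(1)] le_J_trans
      unfolding J_def by blast
    have xm: "le_J x m" using m x by blast
    show "K = J"
    proof
      show "K \<subseteq> J"
        using two_sided_cellD(3)[OF Kc] x(1) mx xm le_J_trans unfolding J_def by blast
      show "J \<subseteq> K"
        using two_sided_cellD(4)[OF Kc x(1) x(1)] mx xm le_J_trans unfolding J_def by blast
    qed
  qed
  moreover obtain z s p where "z \<in> N" "s \<in> {1..n}" "p \<in> star m s" "z \<in> star p m"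
    using sandwich[OF m(1) m(1)] by blast
  then have "p \<in> J" "z \<in> J" "z \<in> star p m"
    using le_sandwich[OF m(1) m(1)] m(2) le_J_trans unfolding J_def by blast+
  ultimately show "apex L \<in> two_sided_cells" "\<exists>p\<in>apex L. \<exists>q\<in>apex L. star p q \<inter> apex L \<noteq> {}"
    using J by auto
qed

section \<open>Idempotent two-sided cells are good\<close>

text \<open>
  With \<open>z\<close> in \<open>p \<star> q\<close>, each \<open>k\<close> in \<open>J\<close> lies in \<open>s \<star> z \<star> t\<close> and so in \<open>(s \<star> p) \<star> (q \<star> t)\<close>. The
  two factors used are above \<open>p\<close>, respectively \<open>q\<close>, and below \<open>k\<close>, so they stay in \<open>J\<close>.
\<close>

lemma idempotent_cell_factor:
  assumes J: "J \<in> two_sided_cells" and idem: "\<exists>p\<in>J. \<exists>q\<in>J. star p q \<inter> J \<noteq> {}" and k: "k \<in> J"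
  shows "\<exists>x\<in>J. \<exists>y\<in>J. k \<in> star x y"
proof -
  note Jn = subsetD[OF two_sided_cellD(1)[OF J]]
  obtain p q z where pqz: "p \<in> J" "q \<in> J" "z \<in> J" "z \<in> star p q" using idem by blast
  obtain s t u where stu: "s \<in> {1..n}" "t \<in> {1..n}" "u \<in> star s z" "k \<in> star u t"
    using two_sided_cellD(3)[OF J pqz(3) k] by (auto simp: le_J_iff)
  obtain x where x: "x \<in> star s p" "u \<in> star x q"
    using star_assocE'[OF pqz(4) stu(3) stu(1) Jn[OF pqz(1)] Jn[OF pqz(2)]] by blast
  obtain y where y: "y \<in> star q t" "k \<in> star x y"
    using star_assocE[OF x(2) stu(4) star_subset[OF x(1)] Jn[OF pqz(2)] stu(2)] by blast
  have "x \<in> J"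
    using two_sided_cellD(4)[OF J pqz(1) k] le_J_star_right[OF stu(1) Jn[OF pqz(1)] x(1)]
      le_J_star_left[OF star_subset[OF x(1)] star_subset[OF y(1)] y(2)] by blast
  moreover have "y \<in> J"
    using two_sided_cellD(4)[OF J pqz(2) k] le_J_star_left[OF Jn[OF pqz(2)] stu(2) y(1)]
      le_J_star_right[OF star_subset[OF x(1)] star_subset[OF y(1)] y(2)] by blast
  ultimately show ?thesis using y by blast
qed

text \<open>
  Write \<open>k\<close> as a product of three elements of \<open>J\<close> and replace the middle one by an expression
  \<open>s \<star> j \<star> t\<close>. The outer factors absorb \<open>s\<close> and \<open>t\<close> and remain in \<open>J\<close>, being squeezed between
  elements of \<open>J\<close>.
\<close>

lemma idempotent_cell_simple:
  assumes J: "J \<in> two_sided_cells" and idem: "\<exists>p\<in>J. \<exists>q\<in>J. star p q \<inter> J \<noteq> {}"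
    and j: "j \<in> J" and k: "k \<in> J"
  shows "\<exists>p\<in>J. \<exists>q\<in>J. \<exists>x\<in>J. x \<in> star p j \<and> k \<in> star x q"
proof -
  note Jn = subsetD[OF two_sided_cellD(1)[OF J]]
  obtain x y where xy: "x \<in> J" "y \<in> J" "k \<in> star x y"
    using idempotent_cell_factor[OF J idem k] by blast
  obtain y1 y2 where y: "y1 \<in> J" "y2 \<in> J" "y \<in> star y1 y2"
    using idempotent_cell_factor[OF J idem xy(2)] by blast
  obtain s t u where stu: "s \<in> {1..n}" "t \<in> {1..n}" "u \<in> star s j" "y1 \<in> star u t"
    using two_sided_cellD(3)[OF J j y(1)] by (auto simp: le_J_iff)
  have u: "u \<in> {1..n}" using star_subset stu by blast
  obtain q where q: "q \<in> star t y2" "y \<in> star u q"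
    using star_assocE[OF stu(4) y(3) u stu(2) Jn[OF y(2)]] by blast
  have qn: "q \<in> {1..n}" using star_subset q by blast
  obtain v where v: "v \<in> star x u" "k \<in> star v q"
    using star_assocE'[OF q(2) xy(3) Jn[OF xy(1)] u qn] by blast
  obtain p where p: "p \<in> star x s" "v \<in> star p j"
    using star_assocE'[OF stu(3) v(1) Jn[OF xy(1)] stu(1) Jn[OF j]] by blast
  have vn: "v \<in> {1..n}" and pn: "p \<in> {1..n}" using star_subset v p by blast+
  have vk: "le_J v k" using le_J_star_left[OF vn qn v(2)] .
  have "p \<in> J"
    using two_sided_cellD(4)[OF J xy(1) k] le_J_star_left[OF Jn[OF xy(1)] stu(1) p(1)]
      le_J_star_left[OF pn Jn[OF j] p(2)] vk le_J_trans by blast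
  moreover have "q \<in> J"
    using two_sided_cellD(4)[OF J y(2) k] le_J_star_right[OF stu(2) Jn[OF y(2)] q(1)]
      le_J_star_right[OF vn qn v(2)] by blast
  moreover have "v \<in> J"
    using two_sided_cellD(4)[OF J j k] le_J_star_right[OF pn Jn[OF j] p(2)] vk by blast
  ultimately show ?thesis using v p by blast
qed

text \<open>
  Discarding all basis elements outside \<open>J\<close> preserves associativity, because an index \<open>m\<close> that
  contributes to an iterated product from \<open>J\<close> to \<open>J\<close> is squeezed between elements of \<open>J\<close>.
\<close>

lemma cell_algebra:
  assumes J: "J \<in> two_sided_cells" and idem: "\<exists>p\<in>J. \<exists>q\<in>J. star p q \<inter> J \<noteq> {}"
  shows "simple_nonneg_algebra J real_const"
proof
  note Jn = subsetD[OF two_sided_cellD(1)[OF J]]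
  show "finite J" using two_sided_cellD(1)[OF J] finite_subset by blast
  show "J \<noteq> {}" using two_sided_cellD(2)[OF J] .
  show "real_const i j k \<ge> 0" if "i \<in> J" "j \<in> J" "k \<in> J" for i j k
    using that Jn real_const_nonneg by blast
  show "\<exists>p\<in>J. \<exists>q\<in>J. \<exists>x\<in>J. real_const p j x > 0 \<and> real_const x q k > 0"
    if jk: "j \<in> J" "k \<in> J" for j k
  proof -
    obtain p q x where "p \<in> J" "q \<in> J" "x \<in> J" "x \<in> star p j" "k \<in> star x q"
      using idempotent_cell_simple[OF J idem jk] by blast
    then show ?thesis unfolding star_def by blast
  qed
  fix i j k l assume ijkl: "i \<in> J" "j \<in> J" "k \<in> J" "l \<in> J"
  have middle: "m \<in> J"
    if xy: "x \<in> J" "y \<in> J" "m \<in> star x y" and l: "le_J m l" for x y m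
  proof -
    have "le_J x m" using le_J_star_left[OF Jn[OF xy(1)] Jn[OF xy(2)] xy(3)] .
    then show ?thesis using two_sided_cellD(4)[OF J xy(1) ijkl(4)] l by blast
  qed
  have pos_star: "z \<in> star x y"
    if "x \<in> {1..n}" "y \<in> {1..n}" "z \<in> {1..n}" "real_const x y z \<noteq> 0" for x y z
    using real_const_nonneg[OF that(1-3)] that by (simp add: star_def)
  have left: "real_const i j m * real_const m k l = 0" if m: "m \<in> {1..n} - J" for m
  proof (rule ccontr)
    assume "real_const i j m * real_const m k l \<noteq> 0"
    then have "m \<in> star i j" "l \<in> star m k"
      using m ijkl[THEN Jn] by (auto intro: pos_star)
    moreover from this have "le_J m l"
      using m Jn[OF ijkl(3)] by (intro le_J_star_left) auto
    ultimately show False using middle[OF ijkl(1,2)] m by blast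
  qed
  have right: "real_const j k m * real_const i m l = 0" if m: "m \<in> {1..n} - J" for m
  proof (rule ccontr)
    assume "real_const j k m * real_const i m l \<noteq> 0"
    then have "m \<in> star j k" "l \<in> star i m"
      using m ijkl[THEN Jn] by (auto intro: pos_star)
    moreover from this have "le_J m l"
      using m Jn[OF ijkl(1)] by (intro le_J_star_right) auto
    ultimately show False using middle[OF ijkl(2,3)] m by blast
  qed
  have "(\<Sum>m\<in>J. real_const i j m * real_const m k l)
      = (\<Sum>m\<in>{1..n}. real_const i j m * real_const m k l)"
    using left by (intro sum.mono_neutral_left two_sided_cellD(1)[OF J] ballI) simp_all
  also have "\<dots> = (\<Sum>m\<in>{1..n}. real_const j k m * real_const i m l)"
    by (rule real_const_assoc[OF ijkl[THEN Jn]])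
  also have "\<dots> = (\<Sum>m\<in>J. real_const j k m * real_const i m l)"
    using right by (intro sum.mono_neutral_right two_sided_cellD(1)[OF J] ballI) simp_all
  finally show "(\<Sum>m\<in>J. real_const i j m * real_const m k l)
      = (\<Sum>m\<in>J. real_const j k m * real_const i m l)" .
qed

text \<open>
  For elements supported on \<open>J\<close>, the product modulo the cell ideal is the product of the cell algebra:
  an index below \<open>J\<close> that occurs in a product of elements of \<open>J\<close> is also above \<open>J\<close>. So the positive
  quasi-idempotent of the cell algebra satisfies \<open>w\<^sup>2 = \<mu> w\<close> there.
\<close>

lemma idempotent_cell_good:
  assumes J: "J \<in> two_sided_cells" and idem: "\<exists>p\<in>J. \<exists>q\<in>J. star p q \<inter> J \<noteq> {}"
  shows "good J"
proof -
  interpret C: simple_nonneg_algebra J real_const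
    using cell_algebra[OF assms] .
  note Jn = subsetD[OF two_sided_cellD(1)[OF J]]
  obtain w \<mu> where w: "\<forall>i\<in>J. w i > 0" "\<forall>i. i \<notin> J \<longrightarrow> w i = 0" and \<mu>: "\<mu> > 0"
    and ww: "C.mul w w = (\<lambda>i. \<mu> * w i)"
    using C.positive_quasi_idempotent by blast
  have JB: "J \<subseteq> below J" using Jn le_J_refl by (auto simp: below_def)
  have Bn: "below J \<subseteq> {1..n}" by (auto simp: below_def)
  then have finB: "finite (below J)" using finite_subset by blast
  have "1 \<in> below J"
  proof -
    obtain j where j: "j \<in> J" using two_sided_cellD(2)[OF J] by blast
    then have "le_J 1 j" using le_J_star_left[OF one_mem Jn[OF j], of j] star_one(1)[OF Jn[OF j]] by simp
    with j one_mem show ?thesis by (auto simp: below_def)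
  qed
  have pow1: "real_power J w 1 = w"
  proof
    fix k
    show "real_power J w 1 k = w k"
    proof (cases "k \<in> below J")
      case True
      have unit: "(\<Sum>j\<in>below J. w i * (if j = 1 then 1 else 0) * real_const i j k)
          = w i * real_const i 1 k" for i
      proof -
        have "(\<Sum>j\<in>below J. w i * (if j = 1 then 1 else 0) * real_const i j k)
            = (\<Sum>j\<in>below J. if j = 1 then w i * real_const i 1 k else 0)"
          by (rule sum.cong[OF refl]) simp
        then show ?thesis using finB \<open>1 \<in> below J\<close> by simp
      qed
      have "real_power J w 1 k = real_mult J w (\<lambda>k. if k = 1 then 1 else 0) k"
        by (simp add: One_nat_def)
      also have "\<dots> = (\<Sum>i\<in>below J. w i * real_const i 1 k)"
        using True by (simp only: real_mult_def unit if_True)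
      also have "\<dots> = (\<Sum>i\<in>below J. if i = k then w i else 0)"
      proof (rule sum.cong[OF refl])
        fix i assume "i \<in> below J"
        then have "i \<in> {1..n}" "k \<in> {1..n}" using True Bn by blast+
        then show "w i * real_const i 1 k = (if i = k then w i else 0)"
          by (simp add: real_const_unit_right del: atLeastAtMost_iff)
      qed
      finally show ?thesis using True finB by simp
    next
      case False
      then have "w k = 0" using w(2) JB by blast
      with False show ?thesis by (simp add: real_mult_def One_nat_def)
    qed
  qed
  have pow2: "real_power J w 2 = (\<lambda>i. \<mu> * w i)"
  proof
    fix k
    have "real_power J w 2 = real_mult J w (real_power J w 1)"
      by (simp add: numeral_2_eq_2 One_nat_def)
    then have "real_power J w 2 k = real_mult J w w k"
      by (simp only: pow1)
    also have "\<dots> = C.mul w w k"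
    proof (cases "k \<in> below J")
      case True
      have "real_mult J w w k = (\<Sum>i\<in>J. \<Sum>j\<in>J. w i * w j * real_const i j k)"
        unfolding real_mult_def using True w JB finB
        by (auto intro!: sum.mono_neutral_cong_right sum.neutral)
      moreover have "(\<Sum>i\<in>J. \<Sum>j\<in>J. w i * w j * real_const i j k) = 0" if "k \<notin> J"
      proof -
        have "real_const i j k = 0" if ij: "i \<in> J" "j \<in> J" for i j
        proof (rule ccontr)
          assume "real_const i j k \<noteq> 0"
          then have "k \<in> star i j"
            using real_const_nonneg[of i j k] ij Jn True Bn by (auto simp: star_def)
          then have "le_J i k" using le_J_star_left ij Jn by blast
          moreover obtain l where "l \<in> J" "le_J k l" using True by (auto simp: below_def)
          ultimately show False using two_sided_cellD(4)[OF J] ij \<open>k \<notin> J\<close> by blast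
        qed
        then show ?thesis by simp
      qed
      ultimately show ?thesis by (auto simp: C.mul_def)
    next
      case False
      then show ?thesis using JB by (auto simp: real_mult_def C.mul_def)
    qed
    finally show "real_power J w 2 k = \<mu> * w k" using ww by simp
  qed
  have "\<forall>t. real_power J w 2 t + (\<Sum>i\<in>{1<..<2}. \<mu> * real_power J w i t)
          = (\<Sum>i\<in>{1..1}. \<mu> * real_power J w i t)"
  proof -
    have "{1<..<2::nat} = {}" by auto
    then show ?thesis using pow1 pow2 by simp
  qed
  then have "\<exists>(m::nat) (k::nat) (l::nat) (v :: nat \<Rightarrow> real).
      m > k \<and> k \<ge> l \<and> l \<ge> 1 \<and> (\<forall>i\<in>{l..<m}. v i \<ge> 0) \<and> v l \<noteq> 0 \<and>
      (\<forall>t. real_power J w m t + (\<Sum>i\<in>{k<..<m}. v i * real_power J w i t)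
         = (\<Sum>i\<in>{l..k}. v i * real_power J w i t))"
    using \<mu> by (intro exI[of _ 2] exI[of _ 1] exI[of _ "\<lambda>_. \<mu>"]) auto
  with J w show ?thesis unfolding good_def by blast
qed

end

theorem corollary20:
  fixes scale :: "'k::field \<Rightarrow> 'a::ring_1 \<Rightarrow> 'a"
    and \<iota> :: "'k \<Rightarrow> complex"
    and n :: nat
    and a :: "nat \<Rightarrow> 'a"
    and \<gamma> :: "nat \<Rightarrow> nat \<Rightarrow> nat \<Rightarrow> 'k"
    and L :: "nat set"
  assumes "positively_based_algebra scale \<iota> n a \<gamma>"
    and "L \<in> positively_based_algebra.left_cells \<iota> n \<gamma>"
  shows "positively_based_algebra.good \<iota> n \<gamma> (positively_based_algebra.apex scale \<iota> n a \<gamma> L)"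
proof -
  interpret positively_based_algebra scale \<iota> n a \<gamma> by (rule assms(1))
  show ?thesis
    using apex_properties[OF assms(2)] by (intro idempotent_cell_good)
qed

end
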